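(* Let $\mathbf{Z}$ be a measurable space, let $N\in\{1,2,\dots\}$, and let $\Omega:=\mathbf{Z}^N$. Let $\mathcal{E}_{\mathrm{iid}}$ be the class of all e-functions with respect to the family of all IID probability measures on $\Omega$, let $\mathcal{E}_{\mathrm{exch}}$ be the class of all e-functions with respect to the family of all exchangeable probability measures on $\Omega$, and let $\mathcal{E}_{\mathrm{conf}}$ be the class of all e-functions with respect to the family of all configuration measures. Then $$\mathcal{E}_{\mathrm{iid}}=\mathcal{E}_{\mathrm{exch}}\,\mathcal{E}_{\mathrm{conf}} .$$
   Context: An e-function with respect to a family of probability measures on a measurable space $X$ is a measurable function $f:X\to[0,\infty]$ such that $\int f\,\mathrm{d}P\le1$ for every $P$ in the family. $\mathbf{Z}^N$ carries the product $\sigma$-algebra. An IID probability measure on $\Omega=\mathbf{Z}^N$ is a measure of the form $Q^N$, where $Q$ is a probability measure on $\mathbf{Z}$. A probability measure $P$ on $\Omega$ is exchangeable if, for any permutation $\pi:\{1,\dots,N\}\to\{1,\dots,N\}$ and any measurable $E\subseteq\mathbf{Z}^N$, $P\{(z_1,\dots,z_N)\mid(z_{\pi(1)},\dots,z_{\pi(N)})\in E\}=P(E)$. The configuration $\mathrm{conf}(\omega)$ of a sequence $\omega\in\Omega$ is the multiset of all elements of $\omega$. The set of all multisets in $\mathbf{Z}$ of size $N$ is equipped with the quotient $\sigma$-algebra (a set $C$ of multisets is measurable iff $\mathrm{conf}^{-1}(C)$ is measurable in $\Omega$). A configuration measure is the pushforward of an IID probability measure on $\Omega$ under the mapping $\mathrm{conf}$;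 it is a probability measure on the set of all multisets in $\mathbf{Z}$ of size $N$. The product $\mathcal{E}_{\mathrm{exch}}\mathcal{E}_{\mathrm{conf}}$ is the set of all measurable functions $f:\Omega\to[0,\infty]$ such that, for some $g\in\mathcal{E}_{\mathrm{exch}}$ and $h\in\mathcal{E}_{\mathrm{conf}}$, the equality $f(\omega)=g(\omega)h(\mathrm{conf}(\omega))$ holds for almost all $\omega\in\Omega$ under every IID probability measure on $\Omega$. The usual convention $0\cdot\infty=0$ is used. *)

theory Defs
  imports "HOL-Probability.Probability" "HOL-Library.Multiset"
begin

text \<open>
  A measure \<open>M\<close> stands for the measurable space \<open>(space M, sets M)\<close> throughout; its
  numerical values are never used. Functions on a measurable space are total HOL functions,
  whose values outside \<open>space\<close> are irrelevant and unconstrained.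
\<close>

definition seq_space :: "'a measure \<Rightarrow> nat \<Rightarrow> (nat \<Rightarrow> 'a) measure" where
  "seq_space M N = (\<Pi>\<^sub>M i\<in>{1..N}. M)"

definition e_functions :: "'b measure \<Rightarrow> 'b measure set \<Rightarrow> ('b \<Rightarrow> ennreal) set" where
  "e_functions X \<P> = {f \<in> borel_measurable X. \<forall>P\<in>\<P>. (\<integral>\<^sup>+ x. f x \<partial>P) \<le> 1}"

definition iid_measures :: "'a measure \<Rightarrow> nat \<Rightarrow> (nat \<Rightarrow> 'a) measure set" where
  "iid_measures M N = {(\<Pi>\<^sub>M i\<in>{1..N}. Q) | Q. prob_space Q \<and> sets Q = sets M}"

definition exch_measures :: "'a measure \<Rightarrow> nat \<Rightarrow> (nat \<Rightarrow> 'a) measure set" where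
  "exch_measures M N =
    {P. prob_space P \<and> sets P = sets (seq_space M N) \<and>
        (\<forall>\<pi> E. \<pi> permutes {1..N} \<longrightarrow> E \<in> sets (seq_space M N) \<longrightarrow>
          emeasure P {z \<in> space (seq_space M N). (\<lambda>i\<in>{1..N}. z (\<pi> i)) \<in> E} = emeasure P E)}"

definition conf :: "nat \<Rightarrow> (nat \<Rightarrow> 'a) \<Rightarrow> 'a multiset" where
  "conf N \<omega> = {# \<omega> i. i \<in># mset_set {1..N} #}"

definition conf_space :: "'a measure \<Rightarrow> nat \<Rightarrow> 'a multiset measure" where
  "conf_space M N =
    (let X = {A. set_mset A \<subseteq> space M \<and> size A = N}
     in sigma X {C. C \<subseteq> X \<and> conf N -` C \<inter> space (seq_space M N) \<in> sets (seq_space M N)})"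

definition conf_measures :: "'a measure \<Rightarrow> nat \<Rightarrow> 'a multiset measure set" where
  "conf_measures M N = (\<lambda>P. distr P (conf_space M N) (conf N)) ` iid_measures M N"

text \<open>In \<^typ>\<open>ennreal\<close>, multiplication satisfies \<open>0 * \<infinity> = 0\<close>.\<close>

definition conf_product ::
  "'a measure \<Rightarrow> nat \<Rightarrow> ((nat \<Rightarrow> 'a) \<Rightarrow> ennreal) set \<Rightarrow> ('a multiset \<Rightarrow> ennreal) set
    \<Rightarrow> ((nat \<Rightarrow> 'a) \<Rightarrow> ennreal) set" where
  "conf_product M N \<G> \<H> =
    {f \<in> borel_measurable (seq_space M N).
      \<exists>g\<in>\<G>. \<exists>h\<in>\<H>. \<forall>P\<in>iid_measures M N. AE \<omega> in P. f \<omega> = g \<omega> * h (conf N \<omega>)}"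

definition E_iid :: "'a measure \<Rightarrow> nat \<Rightarrow> ((nat \<Rightarrow> 'a) \<Rightarrow> ennreal) set" where
  "E_iid M N = e_functions (seq_space M N) (iid_measures M N)"

definition E_exch :: "'a measure \<Rightarrow> nat \<Rightarrow> ((nat \<Rightarrow> 'a) \<Rightarrow> ennreal) set" where
  "E_exch M N = e_functions (seq_space M N) (exch_measures M N)"

definition E_conf :: "'a measure \<Rightarrow> nat \<Rightarrow> ('a multiset \<Rightarrow> ennreal) set" where
  "E_conf M N = e_functions (conf_space M N) (conf_measures M N)"

lemma conf_in_space:
  assumes "\<omega> \<in> space (seq_space M N)"
  shows "set_mset (conf N \<omega>) \<subseteq> space M" "size (conf N \<omega>) = N"
  using assms by (auto simp: conf_def seq_space_def space_PiM)

lemma space_conf_space: "space (conf_space M N) = {A. set_mset A \<subseteq> space M \<and> size A = N}"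
  unfolding conf_space_def Let_def by (rule space_measure_of) auto

text \<open>The generating family of \<^const>\<open>conf_space\<close> is already a \<open>\<sigma>\<close>-algebra, so the
  \<^const>\<open>sigma\<close> in the definition adds no sets: this is the quotient \<open>\<sigma>\<close>-algebra.\<close>

lemma sets_conf_space:
  "sets (conf_space M N) =
    {C. C \<subseteq> space (conf_space M N) \<and>
        conf N -` C \<inter> space (seq_space M N) \<in> sets (seq_space M N)}"
proof -
  let ?X = "{A. set_mset A \<subseteq> space M \<and> size A = N}"
  let ?S = "space (seq_space M N)"
  let ?F = "{C. C \<subseteq> ?X \<and> conf N -` C \<inter> ?S \<in> sets (seq_space M N)}"
  have "sigma_algebra ?X ?F"
    unfolding sigma_algebra_iff2
  proof (intro conjI ballI allI impI)
    fix C assume C: "C \<in> ?F"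
    have "conf N -` (?X - C) \<inter> ?S = ?S - (conf N -` C \<inter> ?S)"
      using conf_in_space[of _ M N] by blast
    with C show "?X - C \<in> ?F" by auto
  next
    fix A :: "nat \<Rightarrow> 'a multiset set" assume A: "range A \<subseteq> ?F"
    then have "A i \<subseteq> ?X" for i by blast
    then have "(\<Union>i. A i) \<subseteq> ?X" by blast
    have "conf N -` (\<Union>i. A i) \<inter> ?S = (\<Union>i. conf N -` A i \<inter> ?S)" by auto
    moreover have "(\<Union>i. conf N -` A i \<inter> ?S) \<in> sets (seq_space M N)"
      using A by (intro sets.countable_UN) auto
    ultimately show "(\<Union>i. A i) \<in> ?F"
      using \<open>(\<Union>i. A i) \<subseteq> ?X\<close> by simp
  qed auto
  then have "sets (sigma ?X ?F) = ?F"
    by (intro sigma_algebra.sets_measure_of_eq)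
  then show ?thesis
    unfolding space_conf_space by (simp only: conf_space_def Let_def)
qed

lemma measurable_conf: "conf N \<in> measurable (seq_space M N) (conf_space M N)"
  by (rule measurableI) (auto simp: space_conf_space sets_conf_space dest: conf_in_space)

end

theory Submission
  imports Defs "HOL-Combinatorics.Permutations"
begin

text \<open>
  Both inclusions come from averaging a function over the orbits of the permutation group acting
  on sequences of length \<open>N\<close> (\<open>orbit_average\<close>). Averaging preserves the integral under every
  exchangeable measure (\<open>nn_integral_orbit_average\<close>), in particular under every IID measure, and
  functions of the configuration can be pulled out of it like constants
  (\<open>orbit_average_mult_invariant\<close>).

  For the inclusion of \<^const>\<open>E_iid\<close> in the product, let \<open>F\<close> be the orbit average of \<open>f\<close>. It is
  constant on orbits, and two sequences lie on the same orbit exactly when they have the same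
  configuration; so \<open>F\<close> is a measurable function \<open>h\<close> of the configuration
  (\<open>invariant_factors_through_conf\<close>), and it integrates to at most 1 under IID measures
  because \<open>f\<close> does. The other factor is \<open>f / F\<close>: its orbit average is
  \<open>F / F \<le> 1\<close>, so it is an e-function under exchangeability. The product \<open>(f / F) * F\<close> recovers \<open>f\<close>
  wherever \<open>F\<close> is finite, hence almost surely under each IID measure.

  For the converse, the uniform distribution on the orbit of a given sequence is itself
  exchangeable, so the orbit average of an exchangeability e-function \<open>g\<close> is at most 1 at every
  single point (\<open>orbit_average_E_exch_le_1\<close>). Averaging \<open>g * (h \<circ> conf)\<close> over orbits thus bounds
  its integral by that of \<open>h \<circ> conf\<close>.
\<close>

section \<open>The action of permutations on sequences\<close>

definition permute_seq :: "nat \<Rightarrow> (nat \<Rightarrow> nat) \<Rightarrow> (nat \<Rightarrow> 'a) \<Rightarrow> nat \<Rightarrow> 'a" where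
  "permute_seq N \<pi> \<omega> = (\<lambda>i\<in>{1..N}. \<omega> (\<pi> i))"

lemma measurable_permute_seq:
  assumes "\<pi> permutes {1..N}"
  shows "permute_seq N \<pi> \<in> measurable (seq_space M N) (seq_space M N)"
  unfolding permute_seq_def seq_space_def
proof (rule measurable_restrict)
  fix i assume "i \<in> {1..N}"
  then have "\<pi> i \<in> {1..N}"
    using assms by (simp only: permutes_in_image)
  then show "(\<lambda>\<omega>. \<omega> (\<pi> i)) \<in> measurable (\<Pi>\<^sub>M i\<in>{1..N}. M) M"
    by (rule measurable_component_singleton)
qed

lemma permute_seq_in_space:
  assumes "\<pi> permutes {1..N}" "\<omega> \<in> space (seq_space M N)"
  shows "permute_seq N \<pi> \<omega> \<in> space (seq_space M N)"
  using measurable_space[OF measurable_permute_seq[OF assms(1)] assms(2)] .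

lemma permute_seq_id:
  assumes "\<omega> \<in> space (seq_space M N)"
  shows "permute_seq N id \<omega> = \<omega>"
  using assms by (auto simp: permute_seq_def seq_space_def space_PiM PiE_def extensional_def)

lemma permute_seq_comp:
  assumes "\<pi> permutes {1..N}"
  shows "permute_seq N \<pi> (permute_seq N \<sigma> \<omega>) = permute_seq N (\<sigma> \<circ> \<pi>) \<omega>"
proof
  fix i
  have "\<pi> i \<in> {1..N} \<longleftrightarrow> i \<in> {1..N}"
    using assms by (simp only: permutes_in_image)
  then show "permute_seq N \<pi> (permute_seq N \<sigma> \<omega>) i = permute_seq N (\<sigma> \<circ> \<pi>) \<omega> i"
    by (simp add: permute_seq_def)
qed

lemma conf_permute_seq:
  assumes "\<pi> permutes {1..N}"
  shows "conf N (permute_seq N \<pi> \<omega>) = conf N \<omega>"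
  unfolding conf_def
  by (rule permutes_implies_image_mset_eq[symmetric, OF assms]) (simp add: permute_seq_def)

lemma conf_eq_imp_permute_seq:
  assumes "\<omega> \<in> space (seq_space M N)" "conf N \<omega> = conf N \<omega>'"
  obtains \<pi> where "\<pi> permutes {1..N}" "\<omega> = permute_seq N \<pi> \<omega>'"
proof -
  obtain \<pi> where \<pi>: "\<pi> permutes {1..N}" "\<forall>i\<in>{1..N}. \<omega> i = \<omega>' (\<pi> i)"
    by (rule image_mset_eq_implies_permutes[OF _ assms(2)[unfolded conf_def]]) auto
  have "\<omega> = permute_seq N \<pi> \<omega>'"
    using assms(1) \<pi>(2)
    by (auto simp: permute_seq_def seq_space_def space_PiM PiE_def extensional_def)
  with \<pi>(1) show thesis by (rule that)
qed

text \<open>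
  Configurations correspond to orbits, so an invariant function may be evaluated at any
  representative of the orbit. Since the quotient \<open>\<sigma>\<close>-algebra is the largest one making \<^const>\<open>conf\<close>
  measurable, the factor is measurable however the representatives are chosen.
\<close>

lemma invariant_factors_through_conf:
  fixes k :: "(nat \<Rightarrow> 'a) \<Rightarrow> 'b::topological_space"
  assumes k: "k \<in> borel_measurable (seq_space M N)"
    and inv: "\<And>\<pi> \<omega>. \<pi> permutes {1..N} \<Longrightarrow> \<omega> \<in> space (seq_space M N) \<Longrightarrow>
      k (permute_seq N \<pi> \<omega>) = k \<omega>"
  shows "\<exists>h\<in>borel_measurable (conf_space M N).
    \<forall>\<omega>\<in>space (seq_space M N). h (conf N \<omega>) = k \<omega>"
proof -
  let ?S = "space (seq_space M N)"
  define h where "h A = k (SOME \<omega>. \<omega> \<in> ?S \<and> conf N \<omega> = A)" for A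
  have h: "h (conf N \<omega>) = k \<omega>" if \<omega>: "\<omega> \<in> ?S" for \<omega>
  proof -
    define \<omega>' where "\<omega>' = (SOME \<omega>'. \<omega>' \<in> ?S \<and> conf N \<omega>' = conf N \<omega>)"
    have "\<omega>' \<in> ?S \<and> conf N \<omega>' = conf N \<omega>"
      unfolding \<omega>'_def by (rule someI[of _ \<omega>]) (simp add: \<omega>)
    then obtain \<pi> where "\<pi> permutes {1..N}" "\<omega>' = permute_seq N \<pi> \<omega>"
      using conf_eq_imp_permute_seq by blast
    then show ?thesis
      using inv \<omega> by (simp add: h_def \<omega>'_def[symmetric])
  qed
  have "h \<in> borel_measurable (conf_space M N)"
  proof (rule measurableI)
    fix B :: "'b set" assume B: "B \<in> sets borel"
    have "conf N -` (h -` B \<inter> space (conf_space M N)) \<inter> ?S = k -` B \<inter> ?S"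
      using h measurable_space[OF measurable_conf] by fastforce
    then show "h -` B \<inter> space (conf_space M N) \<in> sets (conf_space M N)"
      using measurable_sets[OF k B] by (simp add: sets_conf_space)
  qed simp
  then show ?thesis using h by blast
qed

section \<open>Exchangeable measures\<close>

lemma exch_measuresD:
  assumes "P \<in> exch_measures M N"
  shows "prob_space P" "sets P = sets (seq_space M N)" "space P = space (seq_space M N)"
  using assms by (auto simp: exch_measures_def intro!: sets_eq_imp_space_eq)

lemma nn_integral_permute_exch:
  assumes P: "P \<in> exch_measures M N" and \<pi>: "\<pi> permutes {1..N}"
    and f: "f \<in> borel_measurable (seq_space M N)"
  shows "(\<integral>\<^sup>+ \<omega>. f (permute_seq N \<pi> \<omega>) \<partial>P) = (\<integral>\<^sup>+ \<omega>. f \<omega> \<partial>P)"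
proof -
  note [measurable_cong] = exch_measuresD(2)[OF P]
  note [measurable] = measurable_permute_seq[OF \<pi>, of M] f
  note spaceP = exch_measuresD(3)[OF P]
  have "distr P P (permute_seq N \<pi>) = P"
  proof (rule measure_eqI)
    fix E assume "E \<in> sets (distr P P (permute_seq N \<pi>))"
    then have E: "E \<in> sets P" "E \<in> sets (seq_space M N)"
      using exch_measuresD(2)[OF P] by simp_all
    have "emeasure (distr P P (permute_seq N \<pi>)) E =
        emeasure P {z \<in> space (seq_space M N). (\<lambda>i\<in>{1..N}. z (\<pi> i)) \<in> E}"
      using E(1) by (subst emeasure_distr)
        (auto intro!: arg_cong[where f = "emeasure P"] simp: spaceP permute_seq_def)
    also have "\<dots> = emeasure P E"
      using P \<pi> E(2) by (simp add: exch_measures_def)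
    finally show "emeasure (distr P P (permute_seq N \<pi>)) E = emeasure P E" .
  qed simp
  then have "(\<integral>\<^sup>+ \<omega>. f \<omega> \<partial>P) = (\<integral>\<^sup>+ \<omega>. f \<omega> \<partial>distr P P (permute_seq N \<pi>))"
    by simp
  also have "\<dots> = (\<integral>\<^sup>+ \<omega>. f (permute_seq N \<pi> \<omega>) \<partial>P)"
    by (rule nn_integral_distr) measurable
  finally show ?thesis by simp
qed

lemma iid_subset_exch: "iid_measures M N \<subseteq> exch_measures M N"
proof
  fix P assume "P \<in> iid_measures M N"
  then obtain Q where P: "P = (\<Pi>\<^sub>M i\<in>{1..N}. Q)" and Q: "prob_space Q" "sets Q = sets M"
    by (auto simp: iid_measures_def)
  have setsP: "sets P = sets (seq_space M N)"
    unfolding P seq_space_def using Q(2) by (intro sets_PiM_cong) auto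
  then have spaceP: "space P = space (seq_space M N)"
    by (rule sets_eq_imp_space_eq)
  have "prob_space P"
    unfolding P using Q(1) by (intro prob_space_PiM) auto
  moreover have "emeasure P {z \<in> space (seq_space M N). (\<lambda>i\<in>{1..N}. z (\<pi> i)) \<in> E} = emeasure P E"
    if \<pi>: "\<pi> permutes {1..N}" and E: "E \<in> sets (seq_space M N)" for \<pi> E
  proof -
    have T: "permute_seq N \<pi> \<in> measurable P P"
      using measurable_permute_seq[OF \<pi>, of M] setsP measurable_cong_sets by blast
    have "\<pi> \<in> {1..N} \<rightarrow> {1..N}"
      using permutes_in_image[OF \<pi>] by blast
    then have "distr P P (permute_seq N \<pi>) = P"
      using distr_PiM_reindex[of "{1..N}" "\<lambda>_. Q" \<pi> "{1..N}"] Q(1) permutes_inj_on[OF \<pi>]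
      by (simp add: P permute_seq_def[abs_def])
    then have "emeasure P E = emeasure (distr P P (permute_seq N \<pi>)) E"
      by simp
    also have "\<dots> = emeasure P {z \<in> space (seq_space M N). (\<lambda>i\<in>{1..N}. z (\<pi> i)) \<in> E}"
      using E setsP by (subst emeasure_distr[OF T])
        (auto intro!: arg_cong[where f = "emeasure P"] simp: spaceP permute_seq_def)
    finally show ?thesis by simp
  qed
  ultimately show "P \<in> exch_measures M N"
    using setsP by (simp add: exch_measures_def)
qed

section \<open>Averages over orbits\<close>

definition orbit_average :: "nat \<Rightarrow> ((nat \<Rightarrow> 'a) \<Rightarrow> ennreal) \<Rightarrow> (nat \<Rightarrow> 'a) \<Rightarrow> ennreal" where
  "orbit_average N f \<omega> =
    (\<Sum>\<pi> | \<pi> permutes {1..N}. f (permute_seq N \<pi> \<omega>)) / of_nat (card {\<pi>. \<pi> permutes {1..N}})"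

lemma finite_permutes: "finite {\<pi>. \<pi> permutes {1..N::nat}}"
  by (simp add: finite_permutations)

lemma card_permutes_ne_0: "card {\<pi>. \<pi> permutes {1..N::nat}} \<noteq> 0"
  by (simp add: card_permutations[OF refl])

lemma borel_measurable_orbit_average:
  assumes "f \<in> borel_measurable (seq_space M N)"
  shows "orbit_average N f \<in> borel_measurable (seq_space M N)"
  unfolding orbit_average_def[abs_def] using assms
  by (intro borel_measurable_divide_ennreal borel_measurable_sum measurable_const)
    (auto intro: measurable_compose[OF measurable_permute_seq])

lemma orbit_average_invariant:
  assumes \<pi>: "\<pi> permutes {1..N}"
  shows "orbit_average N (\<lambda>\<omega>. f (permute_seq N \<pi> \<omega>)) \<omega> = orbit_average N f \<omega>"
    and "orbit_average N f (permute_seq N \<pi> \<omega>) = orbit_average N f \<omega>"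
  using sum_permutations_compose_right[OF \<pi>, of "\<lambda>\<sigma>. f (permute_seq N \<sigma> \<omega>)"]
    setum_permutations_compose_left[OF \<pi>, of "\<lambda>\<sigma>. f (permute_seq N \<sigma> \<omega>)"]
  by (simp_all add: orbit_average_def permute_seq_comp[of _ N] \<pi> del: One_nat_def)

lemma orbit_average_mult_invariant:
  assumes "\<And>\<pi>. \<pi> permutes {1..N} \<Longrightarrow> k (permute_seq N \<pi> \<omega>) = k \<omega>"
  shows "orbit_average N (\<lambda>\<omega>. f \<omega> * k \<omega>) \<omega> = orbit_average N f \<omega> * k \<omega>"
proof -
  have "(\<Sum>\<pi> | \<pi> permutes {1..N}. f (permute_seq N \<pi> \<omega>) * k (permute_seq N \<pi> \<omega>)) =
      (\<Sum>\<pi> | \<pi> permutes {1..N}. f (permute_seq N \<pi> \<omega>)) * k \<omega>"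
    unfolding sum_distrib_right using assms by (intro sum.cong) simp_all
  then show ?thesis
    unfolding orbit_average_def by (simp only: divide_ennreal_def mult_ac)
qed

lemma nn_integral_orbit_average:
  assumes P: "P \<in> exch_measures M N" and f: "f \<in> borel_measurable (seq_space M N)"
  shows "(\<integral>\<^sup>+ \<omega>. orbit_average N f \<omega> \<partial>P) = (\<integral>\<^sup>+ \<omega>. f \<omega> \<partial>P)"
proof -
  note [measurable_cong] = exch_measuresD(2)[OF P]
  let ?n = "of_nat (card {\<pi>. \<pi> permutes {1..N}}) :: ennreal"
  have T: "(\<lambda>\<omega>. f (permute_seq N \<pi> \<omega>)) \<in> borel_measurable P" if "\<pi> permutes {1..N}" for \<pi>
    using measurable_compose[OF measurable_permute_seq[OF that] f] by measurable
  have "(\<integral>\<^sup>+ \<omega>. orbit_average N f \<omega> \<partial>P) =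
      (\<Sum>\<pi> | \<pi> permutes {1..N}. \<integral>\<^sup>+ \<omega>. f (permute_seq N \<pi> \<omega>) \<partial>P) / ?n"
    unfolding orbit_average_def using T
    by (subst nn_integral_divide) (auto intro!: borel_measurable_sum nn_integral_sum arg_cong2[where f = "(/)"])
  also have "\<dots> = (\<integral>\<^sup>+ \<omega>. f \<omega> \<partial>P) * ?n / ?n"
    using nn_integral_permute_exch[OF P _ f] by (simp add: mult.commute)
  also have "\<dots> = (\<integral>\<^sup>+ \<omega>. f \<omega> \<partial>P)"
    using card_permutes_ne_0 by (intro mult_divide_eq_ennreal) auto
  finally show ?thesis .
qed

text \<open>The identity permutation contributes \<open>f \<omega>\<close> itself to the average.\<close>

lemma orbit_average_eq_0_imp:
  assumes "orbit_average N f \<omega> = 0" "\<omega> \<in> space (seq_space M N)"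
  shows "f \<omega> = 0"
proof -
  have "f (permute_seq N id \<omega>) = 0"
    using assms(1) finite_permutes[of N] permutes_id[of "{1..N}"]
    by (auto simp: orbit_average_def divide_ennreal_def ennreal_inverse_eq_0_iff)
  then show ?thesis
    by (simp add: permute_seq_id[OF assms(2)])
qed

text \<open>
  Orbit averages are integrals with respect to exchangeable measures, namely the uniform
  distributions on orbits.
\<close>

lemma orbit_average_as_exch_integral:
  assumes \<omega>: "\<omega> \<in> space (seq_space M N)"
  obtains P where "P \<in> exch_measures M N"
    "\<And>f. f \<in> borel_measurable (seq_space M N) \<Longrightarrow> (\<integral>\<^sup>+ \<omega>'. f \<omega>' \<partial>P) = orbit_average N f \<omega>"
proof -
  let ?S = "seq_space M N"
  let ?Perms = "{\<pi>. \<pi> permutes {1..N}}"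
  define U where "U = uniform_count_measure ?Perms"
  define P where "P = distr U ?S (\<lambda>\<pi>. permute_seq N \<pi> \<omega>)"
  have T: "(\<lambda>\<pi>. permute_seq N \<pi> \<omega>) \<in> measurable U ?S"
    using permute_seq_in_space[OF _ \<omega>] by (auto simp: U_def uniform_count_measure_def)
  have integral_P: "(\<integral>\<^sup>+ \<omega>'. f \<omega>' \<partial>P) = orbit_average N f \<omega>" if f: "f \<in> borel_measurable ?S" for f
  proof -
    have "ennreal (1 / real (card ?Perms)) = inverse (of_nat (card ?Perms))"
      using card_permutes_ne_0[of N]
      by (simp add: inverse_ennreal divide_inverse ennreal_of_nat_eq_real_of_nat)
    moreover have "(\<integral>\<^sup>+ \<omega>'. f \<omega>' \<partial>P) =
        (\<Sum>\<pi>\<in>?Perms. ennreal (1 / real (card ?Perms)) * f (permute_seq N \<pi> \<omega>))"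
      using f unfolding P_def
      by (subst nn_integral_distr[OF T])
        (simp_all add: U_def uniform_count_measure_def nn_integral_point_measure_finite finite_permutes
          del: One_nat_def)
    ultimately show ?thesis
      by (simp add: orbit_average_def divide_ennreal_def sum_distrib_left mult.commute)
  qed
  have "prob_space P"
    unfolding P_def
  proof (rule prob_space.prob_space_distr[OF _ T])
    show "prob_space U"
      unfolding U_def using finite_permutes permutes_id
      by (intro prob_space_uniform_count_measure) blast+
  qed
  moreover have setsP: "sets P = sets ?S"
    by (simp add: P_def)
  moreover have "emeasure P {z \<in> space ?S. (\<lambda>i\<in>{1..N}. z (\<pi> i)) \<in> E} = emeasure P E"
    if \<pi>: "\<pi> permutes {1..N}" and E: "E \<in> sets ?S" for \<pi> E
  proof -
    have "{z \<in> space ?S. (\<lambda>i\<in>{1..N}. z (\<pi> i)) \<in> E} = permute_seq N \<pi> -` E \<inter> space ?S"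
      by (auto simp: permute_seq_def)
    moreover from this have meas: "{z \<in> space ?S. (\<lambda>i\<in>{1..N}. z (\<pi> i)) \<in> E} \<in> sets ?S"
      using measurable_sets[OF measurable_permute_seq[OF \<pi>] E] by simp
    ultimately have "emeasure P {z \<in> space ?S. (\<lambda>i\<in>{1..N}. z (\<pi> i)) \<in> E} =
        orbit_average N (indicator (permute_seq N \<pi> -` E \<inter> space ?S)) \<omega>"
      using setsP by (simp flip: nn_integral_indicator integral_P)
    also have "\<dots> = orbit_average N (\<lambda>\<omega>'. indicator E (permute_seq N \<pi> \<omega>')) \<omega>"
      using permute_seq_in_space[OF _ \<omega>] by (simp add: orbit_average_def indicator_def)
    also have "\<dots> = orbit_average N (indicator E) \<omega>"
      by (rule orbit_average_invariant(1)[OF \<pi>])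
    also have "\<dots> = emeasure P E"
      using E setsP by (simp flip: integral_P)
    finally show ?thesis .
  qed
  ultimately have "P \<in> exch_measures M N"
    by (simp add: exch_measures_def)
  then show thesis
    using integral_P by (rule that)
qed

lemma orbit_average_E_exch_le_1:
  assumes "g \<in> E_exch M N" "\<omega> \<in> space (seq_space M N)"
  shows "orbit_average N g \<omega> \<le> 1"
proof -
  obtain P where P: "P \<in> exch_measures M N"
    "\<And>f. f \<in> borel_measurable (seq_space M N) \<Longrightarrow> (\<integral>\<^sup>+ \<omega>'. f \<omega>' \<partial>P) = orbit_average N f \<omega>"
    using orbit_average_as_exch_integral[OF assms(2)] by blast
  with assms(1) show ?thesis
    by (fastforce simp: E_exch_def e_functions_def)
qed

section \<open>The factorization\<close>

text \<open>
  By the change of variables formula, e-functions on configurations are e-functions of the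
  configuration under IID measures.
\<close>

lemma E_conf_iff:
  "h \<in> E_conf M N \<longleftrightarrow> h \<in> borel_measurable (conf_space M N) \<and>
    (\<forall>P\<in>iid_measures M N. (\<integral>\<^sup>+ \<omega>. h (conf N \<omega>) \<partial>P) \<le> 1)"
proof -
  have "(\<integral>\<^sup>+ A. h A \<partial>distr P (conf_space M N) (conf N)) = (\<integral>\<^sup>+ \<omega>. h (conf N \<omega>) \<partial>P)"
    if "P \<in> iid_measures M N" "h \<in> borel_measurable (conf_space M N)" for P
  proof -
    have "sets P = sets (seq_space M N)"
      using that(1) iid_subset_exch exch_measuresD(2) by blast
    then have "conf N \<in> measurable P (conf_space M N)"
      using measurable_conf[of N M] measurable_cong_sets by blast
    then show ?thesis
      using that(2) by (simp add: nn_integral_distr)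
  qed
  then show ?thesis
    by (auto simp: E_conf_def e_functions_def conf_measures_def)
qed

lemma E_iid_subset_conf_product: "E_iid M N \<subseteq> conf_product M N (E_exch M N) (E_conf M N)"
proof
  fix f assume "f \<in> E_iid M N"
  then have f: "f \<in> borel_measurable (seq_space M N)"
    and f_le: "\<And>P. P \<in> iid_measures M N \<Longrightarrow> (\<integral>\<^sup>+ \<omega>. f \<omega> \<partial>P) \<le> 1"
    by (auto simp: E_iid_def e_functions_def)
  define F where "F = orbit_average N f"
  \<comment> \<open>With \<open>x / 0 = x * \<infinity>\<close> and \<open>x / \<infinity> = 0\<close>, this is \<open>0\<close> where \<open>F\<close> vanishes (for so does \<open>f\<close>) or is
    infinite, which keeps its orbit average below \<open>1\<close> at every point.\<close>
  define g where "g \<omega> = f \<omega> / F \<omega>" for \<omega>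
  have F: "F \<in> borel_measurable (seq_space M N)"
    unfolding F_def using f by (rule borel_measurable_orbit_average)
  have g: "g \<in> borel_measurable (seq_space M N)"
    unfolding g_def[abs_def] using f F by (rule borel_measurable_divide_ennreal)
  have F_inv: "F (permute_seq N \<pi> \<omega>) = F \<omega>" if "\<pi> permutes {1..N}" for \<pi> \<omega>
    unfolding F_def using that by (rule orbit_average_invariant)
  obtain h where h: "h \<in> borel_measurable (conf_space M N)"
    and hF: "\<And>\<omega>. \<omega> \<in> space (seq_space M N) \<Longrightarrow> h (conf N \<omega>) = F \<omega>"
    using invariant_factors_through_conf[OF F F_inv] by auto
  have F_le: "(\<integral>\<^sup>+ \<omega>. F \<omega> \<partial>P) \<le> 1" if "P \<in> iid_measures M N" for P
    using nn_integral_orbit_average[OF subsetD[OF iid_subset_exch that] f] f_le[OF that]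
    by (simp add: F_def)
  have g_avg: "orbit_average N g \<omega> \<le> 1" for \<omega>
  proof -
    have "orbit_average N g \<omega> = F \<omega> / F \<omega>"
      unfolding g_def[abs_def] divide_ennreal_def
      using orbit_average_mult_invariant[of N "\<lambda>\<omega>. inverse (F \<omega>)" \<omega> f] F_inv
      by (simp add: F_def)
    also have "\<dots> \<le> 1"
      by (cases "F \<omega> = 0 \<or> F \<omega> = top") (auto simp: top.not_eq_extremum)
    finally show ?thesis .
  qed
  have "(\<integral>\<^sup>+ \<omega>. g \<omega> \<partial>P) \<le> 1" if P: "P \<in> exch_measures M N" for P
  proof -
    interpret prob_space P using exch_measuresD(1)[OF P] .
    have "(\<integral>\<^sup>+ \<omega>. g \<omega> \<partial>P) = (\<integral>\<^sup>+ \<omega>. orbit_average N g \<omega> \<partial>P)"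
      using nn_integral_orbit_average[OF P g] by simp
    also have "\<dots> \<le> (\<integral>\<^sup>+ \<omega>. 1 \<partial>P)"
      by (rule nn_integral_mono) (rule g_avg)
    finally show ?thesis by (simp add: emeasure_space_1)
  qed
  then have "g \<in> E_exch M N"
    using g by (simp add: E_exch_def e_functions_def)
  moreover have "h \<in> E_conf M N"
    unfolding E_conf_iff
  proof (intro conjI ballI h)
    fix P assume P: "P \<in> iid_measures M N"
    then have "space P = space (seq_space M N)"
      using iid_subset_exch by (intro exch_measuresD(3)) blast
    then have "(\<integral>\<^sup>+ \<omega>. h (conf N \<omega>) \<partial>P) = (\<integral>\<^sup>+ \<omega>. F \<omega> \<partial>P)"
      using hF by (intro nn_integral_cong) simp
    then show "(\<integral>\<^sup>+ \<omega>. h (conf N \<omega>) \<partial>P) \<le> 1"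
      using F_le[OF P] by simp
  qed
  moreover have "AE \<omega> in P. f \<omega> = g \<omega> * h (conf N \<omega>)" if P: "P \<in> iid_measures M N" for P
  proof -
    have P': "P \<in> exch_measures M N"
      using P iid_subset_exch by blast
    note setsP = exch_measuresD(2)[OF P'] and spaceP = exch_measuresD(3)[OF P']
    have "F \<in> borel_measurable P"
      using F setsP measurable_cong_sets by blast
    then have "AE \<omega> in P. F \<omega> \<noteq> \<infinity>"
      using F_le[OF P] by (intro nn_integral_PInf_AE) (auto simp: top_unique)
    then show ?thesis
    proof (rule AE_mp, intro AE_I2 impI)
      fix \<omega> assume "\<omega> \<in> space P" "F \<omega> \<noteq> \<infinity>"
      then have \<omega>: "\<omega> \<in> space (seq_space M N)" and fin: "F \<omega> < top"
        by (simp_all add: spaceP top.not_eq_extremum)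
      show "f \<omega> = g \<omega> * h (conf N \<omega>)"
      proof (cases "F \<omega> = 0")
        case True
        then have "f \<omega> = 0"
          using orbit_average_eq_0_imp[OF _ \<omega>] by (simp add: F_def)
        then show ?thesis by (simp add: g_def)
      next
        case False
        then show ?thesis
          using fin by (simp add: g_def hF[OF \<omega>] ennreal_divide_times)
      qed
    qed
  qed
  ultimately show "f \<in> conf_product M N (E_exch M N) (E_conf M N)"
    using f by (auto simp: conf_product_def)
qed

lemma conf_product_subset_E_iid: "conf_product M N (E_exch M N) (E_conf M N) \<subseteq> E_iid M N"
proof
  fix f assume "f \<in> conf_product M N (E_exch M N) (E_conf M N)"
  then obtain g h where f: "f \<in> borel_measurable (seq_space M N)"
    and g: "g \<in> E_exch M N" and h: "h \<in> E_conf M N"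
    and eq: "\<And>P. P \<in> iid_measures M N \<Longrightarrow> AE \<omega> in P. f \<omega> = g \<omega> * h (conf N \<omega>)"
    by (auto simp: conf_product_def)
  have g_meas: "g \<in> borel_measurable (seq_space M N)"
    using g by (simp add: E_exch_def e_functions_def)
  have h_meas: "(\<lambda>\<omega>. h (conf N \<omega>)) \<in> borel_measurable (seq_space M N)"
    using h measurable_compose[OF measurable_conf] by (auto simp: E_conf_iff)
  have "(\<integral>\<^sup>+ \<omega>. f \<omega> \<partial>P) \<le> 1" if P: "P \<in> iid_measures M N" for P
  proof -
    have P': "P \<in> exch_measures M N"
      using P iid_subset_exch by blast
    note spaceP = exch_measuresD(3)[OF P']
    have "(\<integral>\<^sup>+ \<omega>. f \<omega> \<partial>P) = (\<integral>\<^sup>+ \<omega>. g \<omega> * h (conf N \<omega>) \<partial>P)"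
      using eq[OF P] by (rule nn_integral_cong_AE)
    also have "\<dots> = (\<integral>\<^sup>+ \<omega>. orbit_average N (\<lambda>\<omega>. g \<omega> * h (conf N \<omega>)) \<omega> \<partial>P)"
      using g_meas h_meas by (intro nn_integral_orbit_average[symmetric, OF P'] borel_measurable_times_ennreal)
    also have "\<dots> = (\<integral>\<^sup>+ \<omega>. orbit_average N g \<omega> * h (conf N \<omega>) \<partial>P)"
      by (intro nn_integral_cong orbit_average_mult_invariant) (simp add: conf_permute_seq)
    also have "\<dots> \<le> (\<integral>\<^sup>+ \<omega>. 1 * h (conf N \<omega>) \<partial>P)"
      using orbit_average_E_exch_le_1[OF g] spaceP by (intro nn_integral_mono mult_right_mono) auto
    also have "\<dots> \<le> 1"
      using h P by (simp add: E_conf_iff)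
    finally show ?thesis .
  qed
  with f show "f \<in> E_iid M N"
    by (simp add: E_iid_def e_functions_def)
qed

theorem corollary15:
  fixes M :: "'a measure" and N :: nat
  assumes "N \<ge> 1"
  shows "E_iid M N = conf_product M N (E_exch M N) (E_conf M N)"
  using E_iid_subset_conf_product conf_product_subset_E_iid by (rule subset_antisym)

end
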